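(* Let $\mathscr{X}$ be a locally finite regular building of type $W$, with chamber set $\mathcal{C}$, Coxeter matrix $(m_{i,j})_{i,j\in I}$ and parameters $\{q_i\}_{i\in I}$. Then: (i) $|\mathcal{C}_w(a)|=q_{i_1}q_{i_2}\cdots q_{i_n}$ for every $a\in\mathcal{C}$ whenever $w=s_{i_1}\cdots s_{i_n}\in W$ is a reduced expression; and (ii) $q_i=q_j$ whenever $m_{i,j}<\infty$ is odd.
   Context: Let $I$ be a finite set and $(m_{i,j})_{i,j\in I}$ a Coxeter matrix ($m_{i,i}=1$, and $m_{i,j}=m_{j,i}\in\{2,3,\ldots\}\cup\{\infty\}$ for $i\neq j$), with Coxeter group $W=\langle s_i\ (i\in I)\mid (s_is_j)^{m_{i,j}}=1\rangle$ (relation omitted when $m_{i,j}=\infty$), $S=\{s_i\mid i\in I\}$, and length function $\ell$. For a word $f=i_1\cdots i_n$ in $I$ write $s_f=s_{i_1}\cdots s_{i_n}$; $f$ is reduced if $\ell(s_f)=n$. A chamber system over $I$ is a set $\mathcal{C}$ (of chambers) with an equivalence relation $\sim_i$ for each $i\in I$. A gallery of type $i_1\cdots i_n$ is a sequence $c_0,\ldots,c_n$ of chambers with $c_{k-1}\sim_{i_k}c_k$ and $c_{k-1}\neq c_k$ for $1\le k\le n$. A building of type $W$ is a chamber system over $I$ such that (1) for each $c\in\mathcal{C}$ and $i\in I$ there is $d\neq c$ with $d\sim_i c$, and (2) there is a function $\delta:\mathcal{C}\times\mathcal{C}\to W$ such that, for every reduced word $f$, $\delta(c,d)=s_f$ if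 and only if $c$ and $d$ can be joined by a gallery of type $f$. It is locally finite if $I$ is finite and $\{b\mid a\sim_i b\}$ is finite for all $a\in\mathcal{C}$, $i\in I$. For $a\in\mathcal{C}$, $w\in W$ put $\mathcal{C}_w(a)=\{b\in\mathcal{C}\mid\delta(a,b)=w\}$. The building is regular if for each $s\in S$ the number $|\mathcal{C}_s(a)|$ does not depend on $a\in\mathcal{C}$; this number is then written $q_s$, with $q_i=q_{s_i}$, and $\{q_s\}_{s\in S}$ is the parameter system. *)

theory Defs
  imports "HOL-Algebra.Group" "HOL-Library.Extended_Nat"
begin

section \<open>Groups given by generators and relators\<close>

text \<open>
  Words in the generators and their formal inverses: the letter \<open>(x, True)\<close> stands for \<open>x\<close>
  and \<open>(x, False)\<close> for its inverse.
\<close>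

definition group_words :: "'x set \<Rightarrow> ('x \<times> bool) list set" where
  "group_words X = lists (X \<times> UNIV)"

inductive_set presentation_rel ::
    "'x set \<Rightarrow> ('x \<times> bool) list set \<Rightarrow> (('x \<times> bool) list \<times> ('x \<times> bool) list) set"
  for X :: "'x set" and R :: "('x \<times> bool) list set" where
  word_refl: "u \<in> group_words X \<Longrightarrow> (u, u) \<in> presentation_rel X R"
| word_sym: "(u, v) \<in> presentation_rel X R \<Longrightarrow> (v, u) \<in> presentation_rel X R"
| word_trans: "(u, v) \<in> presentation_rel X R \<Longrightarrow> (v, w) \<in> presentation_rel X R
    \<Longrightarrow> (u, w) \<in> presentation_rel X R"
| word_cancel: "u \<in> group_words X \<Longrightarrow> v \<in> group_words X \<Longrightarrow> x \<in> X
    \<Longrightarrow> (u @ [(x, b), (x, \<not> b)] @ v, u @ v) \<in> presentation_rel X R"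
| word_relator: "u \<in> group_words X \<Longrightarrow> v \<in> group_words X \<Longrightarrow> r \<in> R \<Longrightarrow> r \<in> group_words X
    \<Longrightarrow> (u @ r @ v, u @ v) \<in> presentation_rel X R"

definition presented_group ::
    "'x set \<Rightarrow> ('x \<times> bool) list set \<Rightarrow> ('x \<times> bool) list set monoid" where
  "presented_group X R =
    \<lparr>carrier = group_words X // presentation_rel X R,
     mult = (\<lambda>A B. \<Union>u\<in>A. \<Union>v\<in>B. presentation_rel X R `` {u @ v}),
     one = presentation_rel X R `` {[]}\<rparr>"

lemma presentation_rel_words:
  "(u, v) \<in> presentation_rel X R \<Longrightarrow> u \<in> group_words X \<and> v \<in> group_words X"
  by (induction rule: presentation_rel.induct) (auto simp: group_words_def)

lemma equiv_presentation_rel: "equiv (group_words X) (presentation_rel X R)"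
proof (rule equivI)
  show "presentation_rel X R \<subseteq> group_words X \<times> group_words X"
    by (auto dest: presentation_rel_words)
  show "refl_on (group_words X) (presentation_rel X R)"
    by (auto simp: refl_on_def intro: presentation_rel.word_refl)
  show "sym (presentation_rel X R)"
    by (rule symI) (rule presentation_rel.word_sym)
  show "trans (presentation_rel X R)"
    by (rule transI) (rule presentation_rel.word_trans)
qed

lemma presentation_rel_append_context:
  assumes "(u, v) \<in> presentation_rel X R" "p \<in> group_words X" "q \<in> group_words X"
  shows "(p @ u @ q, p @ v @ q) \<in> presentation_rel X R"
  using assms
proof (induction rule: presentation_rel.induct)
  case (word_refl u)
  then show ?case by (auto simp: group_words_def intro!: presentation_rel.word_refl)
next
  case (word_sym u v)
  show ?case by (rule presentation_rel.word_sym[OF word_sym.IH[OF word_sym.prems]])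
next
  case (word_trans u v w)
  show ?case
    by (rule presentation_rel.word_trans[OF word_trans.IH(1)[OF word_trans.prems] word_trans.IH(2)[OF word_trans.prems]])
next
  case (word_cancel u v x b)
  then have "p @ u \<in> group_words X" "v @ q \<in> group_words X"
    by (auto simp: group_words_def)
  from presentation_rel.word_cancel[OF this \<open>x \<in> X\<close>, of b R] show ?case by simp
next
  case (word_relator u v r)
  then have "p @ u \<in> group_words X" "v @ q \<in> group_words X"
    by (auto simp: group_words_def)
  from presentation_rel.word_relator[OF this \<open>r \<in> R\<close> \<open>r \<in> group_words X\<close>] show ?case by simp
qed

lemma presentation_rel_append:
  assumes "(u, u') \<in> presentation_rel X R" "(v, v') \<in> presentation_rel X R"
  shows "(u @ v, u' @ v') \<in> presentation_rel X R"
proof (rule presentation_rel.word_trans)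
  show "(u @ v, u' @ v) \<in> presentation_rel X R"
    using presentation_rel_append_context[OF assms(1), of "[]" v] presentation_rel_words[OF assms(2)]
    by (simp add: group_words_def)
  show "(u' @ v, u' @ v') \<in> presentation_rel X R"
    using presentation_rel_append_context[OF assms(2), of u' "[]"] presentation_rel_words[OF assms(1)]
    by (simp add: group_words_def)
qed

lemma presented_group_mult:
  assumes "u \<in> group_words X" "v \<in> group_words X"
  shows "presentation_rel X R `` {u} \<otimes>\<^bsub>presented_group X R\<^esub> presentation_rel X R `` {v}
    = presentation_rel X R `` {u @ v}"
proof -
  let ?r = "presentation_rel X R"
  have eq: "?r `` {u' @ v'} = ?r `` {u @ v}" if "u' \<in> ?r `` {u}" "v' \<in> ?r `` {v}" for u' v'
    using that equiv_class_eq[OF equiv_presentation_rel presentation_rel_append, of u u' X R v v']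
    by simp
  have ne: "?r `` {u} \<noteq> {}" "?r `` {v} \<noteq> {}"
    using presentation_rel.word_refl[OF assms(1), of R] presentation_rel.word_refl[OF assms(2), of R] by blast+
  have "(\<Union>u'\<in>?r `` {u}. \<Union>v'\<in>?r `` {v}. ?r `` {u' @ v'})
      = (\<Union>u'\<in>?r `` {u}. \<Union>v'\<in>?r `` {v}. ?r `` {u @ v})"
    by (intro SUP_cong refl eq)
  also have "\<dots> = ?r `` {u @ v}"
    using ne by (simp only: UN_constant if_False)
  finally show ?thesis
    by (simp only: presented_group_def monoid.simps partial_object.simps)
qed

lemma group_words_inverse:
  "u \<in> group_words X \<Longrightarrow> rev (map (map_prod id Not) u) \<in> group_words X"
  by (fastforce simp: group_words_def in_lists_conv_set)

lemma presentation_rel_inverse: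
  assumes "u \<in> group_words X"
  shows "(rev (map (map_prod id Not) u) @ u, []) \<in> presentation_rel X R"
  using assms
proof (induction u)
  case Nil
  then show ?case by (auto simp: group_words_def intro: presentation_rel.word_refl)
next
  case (Cons a u)
  obtain x b where a: "a = (x, b)" by (cases a)
  have u: "u \<in> group_words X" and x: "x \<in> X"
    using Cons.prems by (auto simp: group_words_def a)
  have "rev (map (map_prod id Not) u) \<in> group_words X"
    using u by (rule group_words_inverse)
  from presentation_rel.word_trans[OF presentation_rel.word_cancel[OF this u x, of "\<not> b" R] Cons.IH[OF u]]
  show ?case by (simp add: a id_def)
qed

lemma group_presented_group: "group (presented_group X R)"
proof (rule groupI)
  have nil: "[] \<in> group_words X" by (simp add: group_words_def)
  have app: "u @ v \<in> group_words X" if "u \<in> group_words X" "v \<in> group_words X" for u v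
    using that by (auto simp: group_words_def)
  let ?G = "presented_group X R"
  have carr: "carrier ?G = group_words X // presentation_rel X R"
    and one: "\<one>\<^bsub>?G\<^esub> = presentation_rel X R `` {[]}"
    by (simp_all add: presented_group_def)
  show "\<one>\<^bsub>?G\<^esub> \<in> carrier ?G"
    unfolding carr one using nil by (rule quotientI)
  fix A B D
  assume "A \<in> carrier ?G"
  then obtain u where u: "u \<in> group_words X" "A = presentation_rel X R `` {u}"
    unfolding carr by (rule quotientE)
  show "\<one>\<^bsub>?G\<^esub> \<otimes>\<^bsub>?G\<^esub> A = A"
    by (simp only: one u(2) presented_group_mult nil u(1) append_Nil)
  let ?v = "rev (map (map_prod id Not) u)"
  have v: "?v \<in> group_words X" using u(1) by (rule group_words_inverse)
  have "presentation_rel X R `` {?v} \<otimes>\<^bsub>?G\<^esub> A = \<one>\<^bsub>?G\<^esub>"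
    unfolding u(2) one presented_group_mult[OF v u(1)]
    by (rule equiv_class_eq[OF equiv_presentation_rel presentation_rel_inverse[OF u(1)]])
  then show "\<exists>B\<in>carrier ?G. B \<otimes>\<^bsub>?G\<^esub> A = \<one>\<^bsub>?G\<^esub>"
    using quotientI[OF v] unfolding carr by blast
  assume "B \<in> carrier ?G"
  then obtain w where w: "w \<in> group_words X" "B = presentation_rel X R `` {w}"
    unfolding carr by (rule quotientE)
  show "A \<otimes>\<^bsub>?G\<^esub> B \<in> carrier ?G"
    unfolding u(2) w(2) presented_group_mult[OF u(1) w(1)] carr
    by (rule quotientI[OF app[OF u(1) w(1)]])
  assume "D \<in> carrier ?G"
  then obtain z where z: "z \<in> group_words X" "D = presentation_rel X R `` {z}"
    unfolding carr by (rule quotientE)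
  show "A \<otimes>\<^bsub>?G\<^esub> B \<otimes>\<^bsub>?G\<^esub> D = A \<otimes>\<^bsub>?G\<^esub> (B \<otimes>\<^bsub>?G\<^esub> D)"
    by (simp only: u(2) w(2) z(2) presented_group_mult app u(1) w(1) z(1) append_assoc)
qed

section \<open>Coxeter groups\<close>

definition coxeter_matrix :: "'i set \<Rightarrow> ('i \<Rightarrow> 'i \<Rightarrow> enat) \<Rightarrow> bool" where
  "coxeter_matrix I m \<longleftrightarrow> finite I \<and> (\<forall>i\<in>I. m i i = 1) \<and>
    (\<forall>i\<in>I. \<forall>j\<in>I. i \<noteq> j \<longrightarrow> m i j = m j i \<and> 2 \<le> m i j)"

definition coxeter_relators :: "'i set \<Rightarrow> ('i \<Rightarrow> 'i \<Rightarrow> enat) \<Rightarrow> ('i \<times> bool) list set" where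
  "coxeter_relators I m =
    {concat (replicate n [(i, True), (j, True)]) | i j n. i \<in> I \<and> j \<in> I \<and> m i j = enat n}"

definition coxeter_group ::
    "'i set \<Rightarrow> ('i \<Rightarrow> 'i \<Rightarrow> enat) \<Rightarrow> ('i \<times> bool) list set monoid" where
  "coxeter_group I m = presented_group I (coxeter_relators I m)"

definition cox_gen ::
    "'i set \<Rightarrow> ('i \<Rightarrow> 'i \<Rightarrow> enat) \<Rightarrow> 'i \<Rightarrow> ('i \<times> bool) list set" where
  "cox_gen I m i = presentation_rel I (coxeter_relators I m) `` {[(i, True)]}"

definition cox_word ::
    "'i set \<Rightarrow> ('i \<Rightarrow> 'i \<Rightarrow> enat) \<Rightarrow> 'i list \<Rightarrow> ('i \<times> bool) list set" where
  "cox_word I m f =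
    foldr (\<lambda>i w. cox_gen I m i \<otimes>\<^bsub>coxeter_group I m\<^esub> w) f \<one>\<^bsub>coxeter_group I m\<^esub>"

definition cox_length ::
    "'i set \<Rightarrow> ('i \<Rightarrow> 'i \<Rightarrow> enat) \<Rightarrow> ('i \<times> bool) list set \<Rightarrow> nat" where
  "cox_length I m w = (LEAST n. \<exists>f\<in>lists I. length f = n \<and> cox_word I m f = w)"

definition reduced_word :: "'i set \<Rightarrow> ('i \<Rightarrow> 'i \<Rightarrow> enat) \<Rightarrow> 'i list \<Rightarrow> bool" where
  "reduced_word I m f \<longleftrightarrow> f \<in> lists I \<and> cox_length I m (cox_word I m f) = length f"

section \<open>Chamber systems and buildings\<close>

definition chamber_system :: "'i set \<Rightarrow> 'c set \<Rightarrow> ('i \<Rightarrow> ('c \<times> 'c) set) \<Rightarrow> bool" where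
  "chamber_system I C E \<longleftrightarrow> (\<forall>i\<in>I. equiv C (E i))"

definition gallery :: "'c set \<Rightarrow> ('i \<Rightarrow> ('c \<times> 'c) set) \<Rightarrow> 'i list \<Rightarrow> 'c list \<Rightarrow> bool" where
  "gallery C E f cs \<longleftrightarrow> length cs = Suc (length f) \<and> set cs \<subseteq> C \<and>
    (\<forall>k<length f. (cs ! k, cs ! Suc k) \<in> E (f ! k) \<and> cs ! k \<noteq> cs ! Suc k)"

definition joined_by_gallery ::
    "'c set \<Rightarrow> ('i \<Rightarrow> ('c \<times> 'c) set) \<Rightarrow> 'i list \<Rightarrow> 'c \<Rightarrow> 'c \<Rightarrow> bool" where
  "joined_by_gallery C E f c d \<longleftrightarrow> (\<exists>cs. gallery C E f cs \<and> hd cs = c \<and> last cs = d)"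

definition weyl_distance ::
    "'i set \<Rightarrow> ('i \<Rightarrow> 'i \<Rightarrow> enat) \<Rightarrow> 'c set \<Rightarrow> ('i \<Rightarrow> ('c \<times> 'c) set)
      \<Rightarrow> ('c \<Rightarrow> 'c \<Rightarrow> ('i \<times> bool) list set) \<Rightarrow> bool" where
  "weyl_distance I m C E \<delta> \<longleftrightarrow>
    (\<forall>c\<in>C. \<forall>d\<in>C. \<delta> c d \<in> carrier (coxeter_group I m)) \<and>
    (\<forall>f. reduced_word I m f \<longrightarrow>
      (\<forall>c\<in>C. \<forall>d\<in>C. \<delta> c d = cox_word I m f \<longleftrightarrow> joined_by_gallery C E f c d))"

definition building ::
    "'i set \<Rightarrow> ('i \<Rightarrow> 'i \<Rightarrow> enat) \<Rightarrow> 'c set \<Rightarrow> ('i \<Rightarrow> ('c \<times> 'c) set) \<Rightarrow> bool" where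
  "building I m C E \<longleftrightarrow> chamber_system I C E \<and>
    (\<forall>c\<in>C. \<forall>i\<in>I. \<exists>d\<in>C. d \<noteq> c \<and> (d, c) \<in> E i) \<and>
    (\<exists>\<delta>. weyl_distance I m C E \<delta>)"

definition locally_finite :: "'i set \<Rightarrow> 'c set \<Rightarrow> ('i \<Rightarrow> ('c \<times> 'c) set) \<Rightarrow> bool" where
  "locally_finite I C E \<longleftrightarrow> finite I \<and> (\<forall>a\<in>C. \<forall>i\<in>I. finite {b\<in>C. (a, b) \<in> E i})"

definition chambers_at ::
    "'c set \<Rightarrow> ('c \<Rightarrow> 'c \<Rightarrow> 'w) \<Rightarrow> 'w \<Rightarrow> 'c \<Rightarrow> 'c set" where
  "chambers_at C \<delta> w a = {b\<in>C. \<delta> a b = w}"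

text \<open>
  Cardinalities are taken with \<^const>\<open>card\<close>, so regularity and the parameters are meaningful
  for locally finite buildings only, the sets \<open>chambers_at C \<delta> s a\<close> being finite there.
\<close>

definition regular_building ::
    "'i set \<Rightarrow> ('i \<Rightarrow> 'i \<Rightarrow> enat) \<Rightarrow> 'c set \<Rightarrow> ('c \<Rightarrow> 'c \<Rightarrow> ('i \<times> bool) list set) \<Rightarrow> bool" where
  "regular_building I m C \<delta> \<longleftrightarrow>
    (\<forall>s\<in>cox_gen I m ` I. \<forall>a\<in>C. \<forall>b\<in>C. card (chambers_at C \<delta> s a) = card (chambers_at C \<delta> s b))"

text \<open>The common cardinality, for a regular building with at least one chamber.\<close>

definition building_param :: "'c set \<Rightarrow> ('c \<Rightarrow> 'c \<Rightarrow> 'w) \<Rightarrow> 'w \<Rightarrow> nat" where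
  "building_param C \<delta> s = (THE n. \<forall>a\<in>C. card (chambers_at C \<delta> s a) = n)"

end

theory Submission
  imports Defs
begin

text \<open>
  For (i), a chamber \<open>b\<close> at distance \<open>w s\<^sub>i\<close> from \<open>a\<close>, with \<open>\<ell>(w s\<^sub>i) = \<ell>(w) + 1\<close>, has exactly one
  \<open>i\<close>-neighbour \<open>c\<close> at distance \<open>w\<close> from \<open>a\<close>: a second one would be reached from \<open>a\<close> through \<open>c\<close>
  by a gallery of reduced type, so it would also be at distance \<open>w s\<^sub>i\<close>. For (ii), if \<open>m\<^sub>i\<^sub>j\<close> is odd then
  \<open>s\<^sub>i\<close> and \<open>s\<^sub>j\<close> are conjugate, say \<open>s\<^sub>j x = x s\<^sub>i\<close>. All relators have even length, so \<open>\<ell>(x s\<^sub>i) \<noteq> \<ell>(x)\<close>,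
  and replacing \<open>x\<close> by \<open>x s\<^sub>i\<close> if necessary one has \<open>\<ell>(x s\<^sub>i) = \<ell>(s\<^sub>j x) = \<ell>(x) + 1\<close>. Computing the
  number of chambers at distance \<open>s\<^sub>j x = x s\<^sub>i\<close> in two ways with (i) gives \<open>q\<^sub>j = q\<^sub>i\<close>. This avoids
  having to know the exact order of \<open>s\<^sub>i s\<^sub>j\<close>.
\<close>

section \<open>Words in a Coxeter group\<close>

lemma map_True_group_words: "f \<in> lists I \<Longrightarrow> map (\<lambda>i. (i, True)) f \<in> group_words I"
  by (auto simp: group_words_def)

text \<open>Products of classes are classes of concatenations. Equalities in the group thereby
  become relations between words, and the arguments below manipulate words only.\<close>

lemma cox_word_eq_class:
  "f \<in> lists I \<Longrightarrow>
    cox_word I m f = presentation_rel I (coxeter_relators I m) `` {map (\<lambda>i. (i, True)) f}"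
proof (induction f)
  case Nil
  then show ?case by (simp add: cox_word_def coxeter_group_def presented_group_def)
next
  case (Cons i f)
  then have "[(i, True)] \<in> group_words I" "map (\<lambda>i. (i, True)) f \<in> group_words I"
    by (auto simp: group_words_def)
  then have "cox_gen I m i \<otimes>\<^bsub>coxeter_group I m\<^esub> cox_word I m f =
      presentation_rel I (coxeter_relators I m) `` {[(i, True)] @ map (\<lambda>i. (i, True)) f}"
    using Cons by (simp only: cox_gen_def coxeter_group_def presented_group_mult Cons_in_lists_iff simp_thms)
  then show ?case by (simp add: cox_word_def)
qed

lemma cox_word_eq_iff:
  assumes "f \<in> lists I" "g \<in> lists I"
  shows "cox_word I m f = cox_word I m g \<longleftrightarrow>
    (map (\<lambda>i. (i, True)) f, map (\<lambda>i. (i, True)) g) \<in> presentation_rel I (coxeter_relators I m)"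
  using eq_equiv_class_iff[OF equiv_presentation_rel map_True_group_words map_True_group_words] assms
  by (simp add: cox_word_eq_class)

lemma cox_word_single: "i \<in> I \<Longrightarrow> cox_word I m [i] = cox_gen I m i"
  by (simp add: cox_word_eq_class cox_gen_def)

lemma cox_word_append_cong:
  assumes "f \<in> lists I" "f' \<in> lists I" "g \<in> lists I" "g' \<in> lists I"
    and "cox_word I m f = cox_word I m f'" "cox_word I m g = cox_word I m g'"
  shows "cox_word I m (f @ g) = cox_word I m (f' @ g')"
  using assms by (simp add: cox_word_eq_iff presentation_rel_append)

lemma concat_replicate_in_lists: "f \<in> lists I \<Longrightarrow> concat (replicate n f) \<in> lists I"
  by (induction n) auto

lemma cox_word_relator:
  assumes "i \<in> I" "j \<in> I" "m i j = enat n"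
  shows "cox_word I m (concat (replicate n [i, j])) = cox_word I m []"
proof -
  let ?r = "concat (replicate n [(i, True), (j, True)])"
  have "?r \<in> group_words I" using assms(1,2) by (induction n) (auto simp: group_words_def)
  moreover have "?r \<in> coxeter_relators I m" using assms by (auto simp: coxeter_relators_def)
  ultimately have "([] @ ?r @ [], [] @ []) \<in> presentation_rel I (coxeter_relators I m)"
    by (intro presentation_rel.word_relator) (auto simp: group_words_def)
  then show ?thesis using assms
    by (simp add: cox_word_eq_iff concat_replicate_in_lists map_concat map_replicate_const)
qed

text \<open>The diagonal entry 1 makes \<open>[i, i]\<close> itself the relator of the pair
  \<open>i\<close>, \<open>i\<close>.\<close>

lemma cox_word_square:
  assumes "coxeter_matrix I m" "i \<in> I"
  shows "cox_word I m [i, i] = cox_word I m []"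
  using cox_word_relator[of i I i m 1] assms by (simp add: coxeter_matrix_def one_enat_def)

lemma cox_word_cancel:
  assumes "coxeter_matrix I m" "i \<in> I" "f \<in> lists I" "g \<in> lists I"
  shows "cox_word I m (f @ i # i # g) = cox_word I m (f @ g)"
proof -
  have "cox_word I m ([i, i] @ g) = cox_word I m ([] @ g)"
    using assms by (intro cox_word_append_cong cox_word_square) auto
  then have "cox_word I m (f @ [i, i] @ g) = cox_word I m (f @ [] @ g)"
    by (rule cox_word_append_cong[rotated 5]) (use assms in auto)
  then show ?thesis by simp
qed

section \<open>Parity of word lengths\<close>

lemma presentation_rel_even_length:
  assumes "(u, v) \<in> presentation_rel X R" and "\<And>r. r \<in> R \<Longrightarrow> even (length r)"
  shows "even (length u) \<longleftrightarrow> even (length v)"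
  using assms by (induction rule: presentation_rel.induct) auto

text \<open>Every relator is a power of a two-letter word, hence of even length. This is the sign
  character of the group, phrased through lengths.\<close>

lemma cox_word_even_length:
  assumes "f \<in> lists I" "g \<in> lists I" "cox_word I m f = cox_word I m g"
  shows "even (length f) \<longleftrightarrow> even (length g)"
proof -
  have "even (length r)" if "r \<in> coxeter_relators I m" for r
    using that by (auto simp: coxeter_relators_def length_concat sum_list_replicate)
  moreover have "(map (\<lambda>i. (i, True)) f, map (\<lambda>i. (i, True)) g)
      \<in> presentation_rel I (coxeter_relators I m)"
    using assms by (simp add: cox_word_eq_iff)
  ultimately show ?thesis using presentation_rel_even_length by fastforce
qed

section \<open>Reduced words\<close>

text \<open>The minimum defining \<open>cox_length\<close> is attained, since \<open>f\<close>
  itself competes for it. Minimality among words can then replace \<open>LEAST\<close> in later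
  arguments.\<close>

lemma reduced_word_iff:
  "reduced_word I m f \<longleftrightarrow>
    f \<in> lists I \<and> (\<forall>g\<in>lists I. cox_word I m g = cox_word I m f \<longrightarrow> length f \<le> length g)"
proof (cases "f \<in> lists I")
  case True
  let ?P = "\<lambda>n. \<exists>g\<in>lists I. length g = n \<and> cox_word I m g = cox_word I m f"
  have "?P (length f)" using True by blast
  then have P: "?P (Least ?P)" by (rule LeastI)
  have le: "Least ?P \<le> length g" if "g \<in> lists I" "cox_word I m g = cox_word I m f" for g
    using that by (intro Least_le) blast
  have "Least ?P = length f \<longleftrightarrow>
      (\<forall>g\<in>lists I. cox_word I m g = cox_word I m f \<longrightarrow> length f \<le> length g)"
    using P le by (metis True le_antisym)
  then show ?thesis using True by (simp add: reduced_word_def cox_length_def)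
qed (simp add: reduced_word_def)

text \<open>A shorter word for either factor would shorten the whole product.\<close>

lemma reduced_word_appendD:
  assumes "reduced_word I m (f @ g)"
  shows "reduced_word I m f" "reduced_word I m g"
proof -
  have fg: "f \<in> lists I" "g \<in> lists I" using assms by (auto simp: reduced_word_iff)
  have min: "length (f @ g) \<le> length h" if "h \<in> lists I" "cox_word I m h = cox_word I m (f @ g)" for h
    using assms that by (auto simp: reduced_word_iff)
  show "reduced_word I m f"
    unfolding reduced_word_iff
  proof (intro conjI ballI impI)
    fix h assume h: "h \<in> lists I" "cox_word I m h = cox_word I m f"
    then show "length f \<le> length h"
      using min[of "h @ g"] cox_word_append_cong[of h I f g g m] fg by simp
  qed (rule fg)
  show "reduced_word I m g"
    unfolding reduced_word_iff
  proof (intro conjI ballI impI)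
    fix h assume h: "h \<in> lists I" "cox_word I m h = cox_word I m g"
    then show "length g \<le> length h"
      using min[of "f @ h"] cox_word_append_cong[of f I f h g m] fg by simp
  qed (rule fg)
qed

lemma ex_reduced_word:
  assumes "f \<in> lists I"
  obtains g where "reduced_word I m g" "cox_word I m g = cox_word I m f"
proof -
  let ?P = "\<lambda>g. g \<in> lists I \<and> cox_word I m g = cox_word I m f"
  obtain g where "?P g" "\<And>h. ?P h \<Longrightarrow> length g \<le> length h"
    using ex_has_least_nat[of ?P f length] assms by blast
  then show thesis by (intro that[of g]) (auto simp: reduced_word_iff)
qed

section \<open>Conjugacy of generators when \<open>m i j\<close> is odd\<close>

lemma cox_word_alternating_inverse:
  assumes "coxeter_matrix I m" "i \<in> I" "j \<in> I"
  shows "cox_word I m (concat (replicate k [i, j]) @ concat (replicate k [j, i])) = cox_word I m []"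
proof (induction k)
  case (Suc k)
  let ?a = "concat (replicate k [i, j])" and ?b = "concat (replicate k [j, i])"
  have ab: "?a \<in> lists I" "?b \<in> lists I" using assms by (auto intro!: concat_replicate_in_lists)
  \<comment> \<open>Unrolling the left power at its right end makes the new letters
    \<open>i, j\<close> and \<open>j, i\<close> meet in the middle, where they cancel.\<close>
  have "concat (replicate (Suc k) [i, j]) = ?a @ [i, j]"
    by (simp flip: replicate_append_same)
  then have "concat (replicate (Suc k) [i, j]) @ concat (replicate (Suc k) [j, i])
      = (?a @ [i]) @ j # j # i # ?b" by simp
  also have "cox_word I m \<dots> = cox_word I m ((?a @ [i]) @ i # ?b)"
    using assms ab by (intro cox_word_cancel) auto
  also have "\<dots> = cox_word I m (?a @ i # i # ?b)" by simp
  also have "\<dots> = cox_word I m (?a @ ?b)"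
    using assms ab by (intro cox_word_cancel) auto
  finally show ?case using Suc.IH by simp
qed simp

text \<open>With \<open>n = 2 * k + 1\<close> the witness is \<open>x = (s_i s_j)^k s_i\<close>.
  Then \<open>s_j x = (s_j s_i)^(k+1)\<close> and \<open>x s_i = (s_i s_j)^k\<close>, which agree
  because \<open>(s_i s_j)^n = 1\<close>.\<close>

lemma odd_order_conjugate:
  assumes "coxeter_matrix I m" "i \<in> I" "j \<in> I" "m i j = enat n" "odd n"
  obtains x where "x \<in> lists I" "cox_word I m (j # x) = cox_word I m (x @ [i])"
proof -
  obtain k where "n = 2 * k + 1" using \<open>odd n\<close> by (rule oddE)
  then have n: "n = k + Suc k" by simp
  let ?a = "\<lambda>k. concat (replicate k [i, j])" and ?b = "\<lambda>k. concat (replicate k [j, i])"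
  have ab: "?a k \<in> lists I" "?b k \<in> lists I" for k
    using assms by (auto intro!: concat_replicate_in_lists)
  have swap: "j # ?a k @ [i] = ?b (Suc k)" for k by (induction k) auto
  \<comment> \<open>The product \<open>(s_i s_j)^n (s_j s_i)^(k+1)\<close> is evaluated twice:
    cancelling the last factor leaves \<open>(s_i s_j)^k\<close>, deleting the relator leaves
    \<open>(s_j s_i)^(k+1)\<close>.\<close>
  have "cox_word I m (?a k @ ?a (Suc k) @ ?b (Suc k)) = cox_word I m (?a k @ [])"
    using assms ab by (intro cox_word_append_cong cox_word_alternating_inverse) auto
  moreover have "cox_word I m (?a n @ ?b (Suc k)) = cox_word I m ([] @ ?b (Suc k))"
    using assms ab by (intro cox_word_append_cong cox_word_relator) auto
  moreover have "?a n = ?a k @ ?a (Suc k)" by (simp only: n replicate_add concat_append)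
  moreover have "cox_word I m (?a k @ [i, i]) = cox_word I m (?a k @ [])"
    using assms ab by (intro cox_word_cancel) auto
  ultimately have "cox_word I m (j # (?a k @ [i])) = cox_word I m ((?a k @ [i]) @ [i])"
    by (simp only: swap append_assoc append_Nil append_Cons)
  then show thesis using assms ab by (intro that[of "?a k @ [i]"]) auto
qed

text \<open>Take a shortest solution \<open>y\<close> of the conjugation equation. A reduced word
  \<open>z\<close> for \<open>y s_i\<close> is again a solution, so it is not shorter than
  \<open>y\<close>, and parity makes it strictly longer.\<close>

lemma conjugate_reduced:
  assumes cm: "coxeter_matrix I m" and i: "i \<in> I" and j: "j \<in> I"
    and "x \<in> lists I" "cox_word I m (j # x) = cox_word I m (x @ [i])"
  obtains y where "cox_word I m (j # y) = cox_word I m (y @ [i])"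
    "reduced_word I m (j # y)" "reduced_word I m (y @ [i])"
proof -
  let ?P = "\<lambda>y. y \<in> lists I \<and> cox_word I m (j # y) = cox_word I m (y @ [i])"
  obtain y where y: "y \<in> lists I" and eq: "cox_word I m (j # y) = cox_word I m (y @ [i])"
    and min: "\<And>z. ?P z \<Longrightarrow> length y \<le> length z"
    using ex_has_least_nat[of ?P x length] assms by blast
  have yi: "y @ [i] \<in> lists I" and jy: "j # y \<in> lists I" using y i j by auto
  obtain z where rz: "reduced_word I m z" and zeq: "cox_word I m z = cox_word I m (y @ [i])"
    using ex_reduced_word[OF yi] .
  have z: "z \<in> lists I" using rz by (simp add: reduced_word_iff)
  have yii: "cox_word I m (y @ [i, i]) = cox_word I m (y @ [])"
    using cm i y by (intro cox_word_cancel) auto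
  \<comment> \<open>\<open>s_j z = s_j s_j y = y\<close> and \<open>z s_i = y s_i s_i = y\<close>,
    so \<open>z\<close> solves the same equation.\<close>
  have "cox_word I m ([j] @ z) = cox_word I m ([j] @ j # y)"
    using z zeq eq j y jy by (intro cox_word_append_cong) auto
  also have "\<dots> = cox_word I m ([] @ y)"
    using cox_word_cancel[of I m j "[]" y] cm j y by simp
  finally have "cox_word I m (j # z) = cox_word I m y" by simp
  moreover have "cox_word I m (z @ [i]) = cox_word I m ((y @ [i]) @ [i])"
    using z zeq i yi by (intro cox_word_append_cong) auto
  ultimately have "?P z" using z yii by simp
  then have "length y \<le> length z" by (rule min)
  moreover have "even (length z) \<longleftrightarrow> even (length (y @ [i]))"
    using z yi zeq by (rule cox_word_even_length)
  ultimately have len: "Suc (length y) \<le> length z"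
    by (cases "length z = length y") auto
  \<comment> \<open>No word for this element is shorter than \<open>z\<close>, hence none is shorter
    than \<open>Suc (length y)\<close>, the length of both \<open>y @ [i]\<close> and
    \<open>j # y\<close>.\<close>
  have "Suc (length y) \<le> length h" if "h \<in> lists I" "cox_word I m h = cox_word I m (y @ [i])" for h
    using rz that zeq len unfolding reduced_word_iff by (metis le_trans)
  then have "reduced_word I m (y @ [i])" "reduced_word I m (j # y)"
    using yi jy eq by (auto simp: reduced_word_iff)
  then show thesis using that eq by blast
qed

section \<open>Galleries and distances in a building\<close>

lemma joined_by_gallery_Nil: "joined_by_gallery C E [] c d \<longleftrightarrow> c \<in> C \<and> d = c"
proof
  assume "joined_by_gallery C E [] c d"
  then show "c \<in> C \<and> d = c"
    by (auto simp: joined_by_gallery_def gallery_def length_Suc_conv)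
next
  assume "c \<in> C \<and> d = c"
  then show "joined_by_gallery C E [] c d"
    unfolding joined_by_gallery_def gallery_def by (intro exI[of _ "[c]"]) auto
qed

text \<open>Galleries are extended at their last chamber, to match the induction on words from the
  right in the count.\<close>

lemma joined_by_gallery_snoc:
  "joined_by_gallery C E (f @ [i]) c d \<longleftrightarrow>
    (\<exists>b. joined_by_gallery C E f c b \<and> d \<in> C \<and> (b, d) \<in> E i \<and> b \<noteq> d)"
proof
  assume "joined_by_gallery C E (f @ [i]) c d"
  then obtain cs where cs: "gallery C E (f @ [i]) cs" "hd cs = c" "last cs = d"
    by (auto simp: joined_by_gallery_def)
  then have len: "length cs = Suc (Suc (length f))" by (simp add: gallery_def)
  then obtain bs where bs: "cs = bs @ [d]" "length bs = Suc (length f)"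
    using cs(3) by (cases cs rule: rev_cases) auto
  then have ne: "bs \<noteq> []" by auto
  have step: "(cs ! k, cs ! Suc k) \<in> E ((f @ [i]) ! k) \<and> cs ! k \<noteq> cs ! Suc k"
    if "k < Suc (length f)" for k
    using cs(1) that by (auto simp: gallery_def)
  have "gallery C E f bs"
    unfolding gallery_def
  proof (intro conjI allI impI)
    fix k assume "k < length f"
    then show "(bs ! k, bs ! Suc k) \<in> E (f ! k)" "bs ! k \<noteq> bs ! Suc k"
      using step[of k] bs by (auto simp: nth_append)
  qed (use bs cs(1) in \<open>auto simp: gallery_def\<close>)
  moreover have "hd bs = c" using bs cs(2) ne by simp
  moreover have "(last bs, d) \<in> E i" "last bs \<noteq> d"
    using step[of "length f"] bs ne by (auto simp: nth_append last_conv_nth)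
  moreover have "d \<in> C" using cs(1) bs by (simp add: gallery_def)
  ultimately show "\<exists>b. joined_by_gallery C E f c b \<and> d \<in> C \<and> (b, d) \<in> E i \<and> b \<noteq> d"
    by (auto simp: joined_by_gallery_def)
next
  assume "\<exists>b. joined_by_gallery C E f c b \<and> d \<in> C \<and> (b, d) \<in> E i \<and> b \<noteq> d"
  then obtain bs where bs: "gallery C E f bs" "hd bs = c" "d \<in> C" "(last bs, d) \<in> E i" "last bs \<noteq> d"
    by (auto simp: joined_by_gallery_def)
  then have len: "length bs = Suc (length f)" and ne: "bs \<noteq> []" by (auto simp: gallery_def)
  have "gallery C E (f @ [i]) (bs @ [d])"
    unfolding gallery_def
  proof (intro conjI allI impI)
    fix k assume "k < length (f @ [i])"
    then consider "k < length f" | "k = length f" by fastforce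
    then have "((bs @ [d]) ! k, (bs @ [d]) ! Suc k) \<in> E ((f @ [i]) ! k) \<and>
        (bs @ [d]) ! k \<noteq> (bs @ [d]) ! Suc k"
      using bs len ne by cases (auto simp: gallery_def nth_append last_conv_nth)
    then show "((bs @ [d]) ! k, (bs @ [d]) ! Suc k) \<in> E ((f @ [i]) ! k)"
      "(bs @ [d]) ! k \<noteq> (bs @ [d]) ! Suc k" by auto
  qed (use bs len in \<open>auto simp: gallery_def\<close>)
  then show "joined_by_gallery C E (f @ [i]) c d"
    using bs ne unfolding joined_by_gallery_def by (intro exI[of _ "bs @ [d]"]) auto
qed

lemma joined_by_gallery_in: "joined_by_gallery C E f c d \<Longrightarrow> c \<in> C \<and> d \<in> C"
proof -
  assume "joined_by_gallery C E f c d"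
  then obtain cs where cs: "gallery C E f cs" "hd cs = c" "last cs = d"
    by (auto simp: joined_by_gallery_def)
  then have "set cs \<subseteq> C" "cs \<noteq> []" by (auto simp: gallery_def)
  with cs show ?thesis using hd_in_set last_in_set by blast
qed

section \<open>Counting the chambers at a given distance\<close>

lemma chambers_at_reduced:
  assumes "weyl_distance I m C E \<delta>" "reduced_word I m f" "a \<in> C"
  shows "chambers_at C \<delta> (cox_word I m f) a = {b. joined_by_gallery C E f a b}"
proof -
  have "\<delta> a b = cox_word I m f \<longleftrightarrow> joined_by_gallery C E f a b" if "b \<in> C" for b
    using assms that by (simp add: weyl_distance_def)
  \<comment> \<open>The equivalence above covers members of \<open>C\<close> only; that the end of a
    gallery lies in \<open>C\<close> comes from the gallery itself.\<close>
  then show ?thesis by (auto simp: chambers_at_def dest: joined_by_gallery_in)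
qed

lemma reduced_word_snoc_neq:
  assumes "reduced_word I m (f @ [i])"
  shows "cox_word I m (f @ [i]) \<noteq> cox_word I m f"
  using assms by (auto simp: reduced_word_iff)

text \<open>Parity separates \<open>s_i\<close> from the identity, so the empty word does not
  represent it.\<close>

lemma reduced_word_single:
  assumes "i \<in> I" shows "reduced_word I m [i]"
proof -
  have "length g \<ge> 1" if "g \<in> lists I" "cox_word I m g = cox_word I m [i]" for g
    using cox_word_even_length[OF that(1) _ that(2)] assms by (cases g) auto
  then show ?thesis using assms by (auto simp: reduced_word_iff)
qed

lemma chambers_at_gen:
  assumes "weyl_distance I m C E \<delta>" "i \<in> I" "a \<in> C"
  shows "chambers_at C \<delta> (cox_gen I m i) a = {b \<in> C. (a, b) \<in> E i \<and> a \<noteq> b}"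
  using chambers_at_reduced[OF assms(1) reduced_word_single[OF assms(2)] assms(3)] assms
    joined_by_gallery_snoc[of C E "[]" i a]
  by (auto simp: cox_word_single joined_by_gallery_Nil)

text \<open>A gallery of type \<open>f @ [i]\<close> is split at its penultimate chamber
  \<open>c\<close>.\<close>

lemma chambers_at_snoc:
  assumes "weyl_distance I m C E \<delta>" "reduced_word I m (f @ [i])" "a \<in> C"
  shows "chambers_at C \<delta> (cox_word I m (f @ [i])) a =
    (\<Union>c\<in>chambers_at C \<delta> (cox_word I m f) a. chambers_at C \<delta> (cox_gen I m i) c)"
proof -
  have "i \<in> I" using assms(2) by (simp add: reduced_word_iff)
  then have "chambers_at C \<delta> (cox_gen I m i) c = {b \<in> C. (c, b) \<in> E i \<and> c \<noteq> b}"
    if "joined_by_gallery C E f a c" for c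
    using chambers_at_gen[OF assms(1)] joined_by_gallery_in[OF that] by blast
  then show ?thesis
    using reduced_word_appendD(1)[OF assms(2)] assms
    by (auto simp: chambers_at_reduced joined_by_gallery_snoc)
qed

text \<open>The penultimate chamber is determined by the last one, so cardinalities add up over the
  union.\<close>

lemma chambers_at_gen_disjoint:
  assumes cs: "chamber_system I C E" and wd: "weyl_distance I m C E \<delta>"
    and red: "reduced_word I m (f @ [i])" and a: "a \<in> C"
    and c: "c \<in> chambers_at C \<delta> (cox_word I m f) a"
    and d: "d \<in> chambers_at C \<delta> (cox_word I m f) a" and "c \<noteq> d"
  shows "chambers_at C \<delta> (cox_gen I m i) c \<inter> chambers_at C \<delta> (cox_gen I m i) d = {}"
proof (rule ccontr)
  assume "\<not> ?thesis"
  then obtain b where b: "b \<in> chambers_at C \<delta> (cox_gen I m i) c" "b \<in> chambers_at C \<delta> (cox_gen I m i) d"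
    by blast
  have i: "i \<in> I" using red by (simp add: reduced_word_iff)
  then have "equiv C (E i)" using cs by (simp add: chamber_system_def)
  moreover have cd: "c \<in> C" "d \<in> C" using c d by (auto simp: chambers_at_def)
  then have "(c, b) \<in> E i" "(d, b) \<in> E i" using b chambers_at_gen[OF wd i] by auto
  \<comment> \<open>Two \<open>i\<close>-neighbours of \<open>b\<close> are
    \<open>i\<close>-equivalent to each other, so a gallery ending in \<open>c\<close> can be
    prolonged to \<open>d\<close>.\<close>
  ultimately have "(c, d) \<in> E i" by (meson equivE symD transD)
  moreover have "joined_by_gallery C E f a c"
    using c chambers_at_reduced[OF wd reduced_word_appendD(1)[OF red] a] by simp
  ultimately have "joined_by_gallery C E (f @ [i]) a d"
    using cd \<open>c \<noteq> d\<close> by (auto simp: joined_by_gallery_snoc)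
  \<comment> \<open>Since \<open>f @ [i]\<close> is reduced, the gallery determines the distance,
    and \<open>d\<close> would have two distances from \<open>a\<close>.\<close>
  then have "\<delta> a d = cox_word I m (f @ [i])"
    using chambers_at_reduced[OF wd red a] by (auto simp: chambers_at_def)
  then show False using d reduced_word_snoc_neq[OF red] by (simp add: chambers_at_def)
qed

text \<open>Each chamber at distance \<open>s_f\<close> contributes \<open>q i\<close> chambers at
  distance \<open>s_f s_i\<close>, without overlap. Finiteness is carried through the induction
  because the cardinality of a disjoint union is computed from it.\<close>

lemma card_chambers_at:
  assumes cs: "chamber_system I C E" and wd: "weyl_distance I m C E \<delta>" and a: "a \<in> C"
    and fin: "\<And>i c. i \<in> I \<Longrightarrow> c \<in> C \<Longrightarrow> finite (chambers_at C \<delta> (cox_gen I m i) c)"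
    and q: "\<And>i c. i \<in> I \<Longrightarrow> c \<in> C \<Longrightarrow> card (chambers_at C \<delta> (cox_gen I m i) c) = q i"
  shows "reduced_word I m f \<Longrightarrow>
    finite (chambers_at C \<delta> (cox_word I m f) a) \<and>
    card (chambers_at C \<delta> (cox_word I m f) a) = (\<Prod>i\<leftarrow>f. q i)"
proof (induction f rule: rev_induct)
  case Nil
  then show ?case using a by (simp add: chambers_at_reduced[OF wd] joined_by_gallery_Nil)
next
  case (snoc i f)
  let ?A = "chambers_at C \<delta> (cox_word I m f) a" and ?B = "chambers_at C \<delta> (cox_gen I m i)"
  have A: "finite ?A" "card ?A = (\<Prod>i\<leftarrow>f. q i)"
    using snoc.IH reduced_word_appendD(1)[OF snoc.prems] by auto
  have i: "i \<in> I" using snoc.prems by (simp add: reduced_word_iff)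
  have sub: "?A \<subseteq> C" by (auto simp: chambers_at_def)
  have "card (\<Union>c\<in>?A. ?B c) = (\<Sum>c\<in>?A. card (?B c))"
    using A(1) fin[OF i] sub chambers_at_gen_disjoint[OF cs wd snoc.prems a]
    by (intro card_UN_disjoint) auto
  also have "\<dots> = (\<Sum>c\<in>?A. q i)" using q[OF i] sub by (intro sum.cong) auto
  finally show ?case
    using A fin[OF i] sub by (auto simp: chambers_at_snoc[OF wd snoc.prems a])
qed

theorem proposition2p1:
  fixes I :: "'i set"
    and m :: "'i \<Rightarrow> 'i \<Rightarrow> enat"
    and C :: "'c set"
    and E :: "'i \<Rightarrow> ('c \<times> 'c) set"
    and \<delta> :: "'c \<Rightarrow> 'c \<Rightarrow> ('i \<times> bool) list set"
    and q :: "'i \<Rightarrow> nat"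
  assumes "coxeter_matrix I m"
    and "building I m C E"
    and "weyl_distance I m C E \<delta>"
    and "locally_finite I C E"
    and "regular_building I m C \<delta>"
    and "\<And>i. i \<in> I \<Longrightarrow> q i = building_param C \<delta> (cox_gen I m i)"
  shows "(\<forall>a\<in>C. \<forall>w f. reduced_word I m f \<and> w = cox_word I m f \<longrightarrow>
            card (chambers_at C \<delta> w a) = (\<Prod>i\<leftarrow>f. q i)) \<and>
         (\<forall>i\<in>I. \<forall>j\<in>I. \<forall>n. m i j = enat n \<and> odd n \<longrightarrow> q i = q j)"
proof -
  have cs: "chamber_system I C E" using assms(2) by (simp add: building_def)
  note gen = chambers_at_gen[OF assms(3)]
  have fin: "finite (chambers_at C \<delta> (cox_gen I m i) c)" if "i \<in> I" "c \<in> C" for i c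
  proof (rule finite_subset)
    show "finite {b \<in> C. (c, b) \<in> E i}" using assms(4) that by (simp add: locally_finite_def)
  qed (use gen[OF that] in auto)
  have q: "card (chambers_at C \<delta> (cox_gen I m i) c) = q i" if "i \<in> I" "c \<in> C" for i c
  proof -
    have "\<forall>b\<in>C. card (chambers_at C \<delta> (cox_gen I m i) b) = card (chambers_at C \<delta> (cox_gen I m i) c)"
      using assms(5) that unfolding regular_building_def by blast
    \<comment> \<open>The chamber \<open>c\<close> pins down the number that \<open>THE\<close>
      selects.\<close>
    then have "building_param C \<delta> (cox_gen I m i) = card (chambers_at C \<delta> (cox_gen I m i) c)"
      unfolding building_param_def using that(2) by (intro the_equality) (blast, metis)
    then show ?thesis using assms(6)[OF that(1)] by simp
  qed
  have count: "card (chambers_at C \<delta> (cox_word I m f) a) = (\<Prod>i\<leftarrow>f. q i)"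
    if "a \<in> C" "reduced_word I m f" for a f
    using card_chambers_at[OF cs assms(3) that(1) fin q that(2)] by simp
  have "q i = q j" if ij: "i \<in> I" "j \<in> I" and n: "m i j = enat n" "odd n" for i j n
  proof (cases "C = {}")
    case True \<comment> \<open>then \<open>building_param\<close> does not depend on the generator\<close>
    then show ?thesis using assms(6) ij by (simp add: building_param_def)
  next
    case False
    then obtain a where a: "a \<in> C" by blast
    obtain x where "x \<in> lists I" "cox_word I m (j # x) = cox_word I m (x @ [i])"
      using odd_order_conjugate[OF assms(1) ij n] .
    then obtain y where eq: "cox_word I m (j # y) = cox_word I m (y @ [i])"
      and red: "reduced_word I m (j # y)" "reduced_word I m (y @ [i])"
      using conjugate_reduced[OF assms(1) ij] by blast
    \<comment> \<open>To cancel the product over \<open>y\<close> below, the parameters must be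
      nonzero: each chamber has a \<open>k\<close>-neighbour other than itself.\<close>
    have "q k \<noteq> 0" if "k \<in> I" for k
    proof -
      have "\<exists>d\<in>C. d \<noteq> a \<and> (d, a) \<in> E k"
        using assms(2) that a by (simp add: building_def)
      then obtain d where "d \<in> C" "d \<noteq> a" "(d, a) \<in> E k" by blast
      moreover have "equiv C (E k)" using cs that by (simp add: chamber_system_def)
      then have "sym (E k)" by (rule equivE)
      ultimately have "d \<in> chambers_at C \<delta> (cox_gen I m k) a"
        using gen[OF that a] by (auto dest: symD)
      then show ?thesis using fin[OF that a] q[OF that a] card_gt_0_iff by fastforce
    qed
    moreover have "set y \<subseteq> I" using red(1) by (auto simp: reduced_word_iff)
    ultimately have "0 \<notin> q ` set y" by (metis imageE subsetD)
    then have "(\<Prod>k\<leftarrow>y. q k) \<noteq> 0" by (simp add: prod_list_zero_iff)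
    \<comment> \<open>Both sides count the chambers at the same distance from \<open>a\<close>, once
      through \<open>y @ [i]\<close> and once through \<open>j # y\<close>.\<close>
    moreover have "(\<Prod>k\<leftarrow>y. q k) * q i = (\<Prod>k\<leftarrow>y. q k) * q j"
      using count[OF a red(1)] count[OF a red(2)] by (auto simp: eq)
    ultimately show ?thesis by simp
  qed
  then show ?thesis using count by blast
qed

end
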